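(* The number of arithmetical structures on $\mathcal{P}_{1,n}$ is given by $4C_n-2C_{n-1}$, where $C_n=\frac{1}{n+1}\binom{2n}{n}$ is the $n$th Catalan number.
   Context: An arithmetical structure on a graph $G$ is an assignment to each vertex of a nonnegative integer label such that the set of all labels has gcd $1$ and the label of each vertex divides the sum of the labels of its neighbors, counted with multiplicity. The graph $\mathcal{P}_{1,n}$ has vertices $a_1,b_1,\ldots,b_n$, a single edge between $b_i$ and $b_{i+1}$ ($1\le i<n$), and two edges between $a_1$ and $b_1$. Structures are counted with the two sides distinguished (e.g. on $\mathcal{P}_{1,1}$, $a_1=2,b_1=1$ and $a_1=1,b_1=2$ are different).
   Formalization: The formal theorem assumes n ≥ 2: for n = 1 the formula gives 4C_1 − 2C_0 = 2, but P_{1,1} has three arithmetical structures, (a_1,b_1) = (1,1), (1,2), (2,1). *)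

theory Defs
  imports Complex_Main "HOL-Library.Multiset" "HOL-Library.FuncSet"
begin

record 'v multigraph =
  verts :: "'v set"
  edges :: "'v set multiset"

definition loopless_multigraph :: "'v multigraph \<Rightarrow> bool" where
  "loopless_multigraph G \<longleftrightarrow>
     finite (verts G) \<and> (\<forall>e \<in># edges G. e \<subseteq> verts G \<and> card e = 2)"

definition neighbor_sum :: "'v multigraph \<Rightarrow> ('v \<Rightarrow> nat) \<Rightarrow> 'v \<Rightarrow> nat" where
  "neighbor_sum G r v = (\<Sum>w \<in> verts G - {v}. count (edges G) {v, w} * r w)"

text \<open>
  Labelings are extensional functions on the vertex set, so that two labelings
  which agree on all vertices are counted once. On \<open>nat\<close>, \<open>0 dvd m\<close> means \<open>m = 0\<close>.
\<close>
definition arithmetical_structures :: "'v multigraph \<Rightarrow> ('v \<Rightarrow> nat) set" where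
  "arithmetical_structures G =
     {r \<in> verts G \<rightarrow>\<^sub>E UNIV.
        Gcd (r ` verts G) = 1 \<and> (\<forall>v \<in> verts G. r v dvd neighbor_sum G r v)}"

datatype path_vertex = A1 | B nat

definition P1 :: "nat \<Rightarrow> path_vertex multigraph" where
  "P1 n = \<lparr> verts = insert A1 (B ` {1..n}),
            edges = {#{A1, B 1}, {A1, B 1}#} + {#{B i, B (i + 1)}. i \<in># mset_set {1..<n}#} \<rparr>"

lemma loopless_multigraph_P1:
  assumes "n \<ge> 1"
  shows "loopless_multigraph (P1 n)"
  using assms by (auto simp: loopless_multigraph_def P1_def)

definition catalan :: "nat \<Rightarrow> real" where
  "catalan n = 1 / (real n + 1) * real ((2 * n) choose n)"

text \<open>
  The formula \<open>4 * catalan n - 2 * catalan (n - 1)\<close> gives \<open>2\<close> for \<open>n = 1\<close>, whereas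
  \<open>P1 1\<close> has the three structures \<open>(1, 1)\<close>, \<open>(1, 2)\<close>, \<open>(2, 1)\<close>; it can
  therefore only hold for \<open>n \<ge> 2\<close>.
\<close>
lemma card_arithmetical_structures_P1_1: "card (arithmetical_structures (P1 1)) = 3"
proof -
  let ?f = "\<lambda>(x, y) v. if v = A1 then x else if v = B 1 then y else (undefined :: nat)"
  let ?S = "{(1, 1), (1, 2), (2, 1)} :: (nat \<times> nat) set"
  have verts: "verts (P1 1) = {A1, B 1}"
    by (simp add: P1_def)
  have sumA: "neighbor_sum (P1 1) r A1 = 2 * r (B 1)" for r
    by (simp add: neighbor_sum_def P1_def)
  have sumB: "neighbor_sum (P1 1) r (B 1) = 2 * r A1" for r
  proof -
    have "{A1, B 1} - {B 1} = {A1}" by auto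
    then show ?thesis
      by (simp add: neighbor_sum_def P1_def insert_commute)
  qed
  have solve: "(x, y) \<in> ?S" if "x dvd 2 * y" "y dvd 2 * x" "gcd x y = 1" for x y :: nat
  proof -
    have "coprime x y" using that(3) by (simp add: coprime_iff_gcd_eq_1)
    then have d: "x dvd 2" "y dvd 2"
      using that by (metis coprime_commute coprime_dvd_mult_left_iff)+
    then have "x \<le> 2" "y \<le> 2"
      by (auto dest: dvd_imp_le)
    moreover have "x \<noteq> 0" "y \<noteq> 0"
      using d by (auto intro: Nat.gr0I)
    ultimately have "x = 1 \<or> x = 2" "y = 1 \<or> y = 2" by auto
    then show ?thesis using that(3) by auto
  qed
  have "arithmetical_structures (P1 1) = ?f ` ?S"
  proof (intro set_eqI iffI)
    fix r assume r: "r \<in> arithmetical_structures (P1 1)"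
    have "(r A1, r (B 1)) \<in> ?S"
      using r by (intro solve)
        (auto simp: arithmetical_structures_def verts sumA sumB simp del: One_nat_def)
    moreover have "r = ?f (r A1, r (B 1))"
      using r by (auto simp: arithmetical_structures_def verts PiE_def extensional_def fun_eq_iff
               simp del: One_nat_def)
    ultimately show "r \<in> ?f ` ?S" by blast
  next
    fix r assume "r \<in> ?f ` ?S"
    then show "r \<in> arithmetical_structures (P1 1)"
      by (auto simp: arithmetical_structures_def verts sumA sumB PiE_def extensional_def
               simp del: One_nat_def)
  qed
  moreover have "inj ?f"
    by (rule injI) (auto simp: fun_eq_iff split: if_splits dest: spec[of _ A1] spec[of _ "B 1"])
  then have "card (?f ` ?S) = card ?S"
    by (rule card_image[OF inj_on_subset[OF _ subset_UNIV]])
  ultimately have "card (arithmetical_structures (P1 1)) = card ?S"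
    by metis
  then show ?thesis
    by simp
qed

end

theory Submission
  imports Defs "HOL-Number_Theory.Cong"
begin

text \<open>
  Appending the value 0 and replacing the label \<open>a\<close> of \<open>A1\<close> by \<open>2 * a\<close>, a structure becomes a
  sequence \<open>2a, b\<^sub>1, \<dots>, b\<^sub>n, 0\<close> in which every \<open>b\<^sub>i\<close> divides the sum of its neighbors. The last
  label \<open>b\<^sub>n\<close> divides all terms, so it is coprime to \<open>a\<close> and divides 2; together with
  \<open>a dvd 2 * b\<^sub>1\<close> this leaves sequences ending in 1 and starting with 2 or 4 (when \<open>b\<^sub>n = 1\<close>), and twice
  a sequence ending in 1 and starting with 1 (when \<open>b\<^sub>n = 2\<close>, \<open>a = 1\<close>).

  Removing terms that equal the sum of their neighbors reduces such a sequence to a strictly decreasing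
  one, namely \<open>1, 0\<close> or \<open>2, 1, 0\<close> or one of \<open>4, 1, 0\<close> and \<open>4, 3, 2, 1, 0\<close>. Conversely, the
  insertions into one gap are encoded by a binary tree, so \<open>k + 1\<close> gaps contribute a \<open>(k + 1)\<close>-fold
  Catalan convolution: \<open>C\<^sub>n\<close>, \<open>C\<^sub>n\<close>, and \<open>C\<^sub>n + (C\<^sub>n - 2 C\<^bsub>n - 1\<^esub>)\<close> respectively.
\<close>

section \<open>The Catalan recurrence\<close>

lemma central_binomial_Suc:
  "(real n + 1) * real ((2 * Suc n) choose Suc n) = 2 * (2 * real n + 1) * real ((2 * n) choose n)"
proof -
  have 1: "Suc n * ((2 * Suc n) choose Suc n) = (2 * Suc n) * (Suc (2 * n) choose n)"
    using Suc_times_binomial_eq[of "Suc (2 * n)" n] by (simp add: mult.commute)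
  have 2: "Suc n * (Suc (2 * n) choose n) = Suc (2 * n) * ((2 * n) choose n)"
    using binomial_absorb_comp[of "Suc (2 * n)" n] by simp
  have "Suc n * (Suc n * ((2 * Suc n) choose Suc n)) = 2 * Suc n * (Suc (2 * n) * ((2 * n) choose n))"
    unfolding 1 2[symmetric] by (simp add: ac_simps)
  then have "Suc n * ((2 * Suc n) choose Suc n) = 2 * (Suc (2 * n) * ((2 * n) choose n))"
    using mult_left_cancel[of "Suc n"] by (metis (no_types, lifting) mult.assoc mult.left_commute nat.distinct(1))
  then have "real (Suc n * ((2 * Suc n) choose Suc n)) = real (2 * (Suc (2 * n) * ((2 * n) choose n)))"
    by metis
  then show ?thesis
    by (simp del: binomial_Suc_Suc mult_Suc_right add: algebra_simps)
qed

text \<open>One telescoping step of \<open>catalan_Suc\<close>, with \<open>x = i\<close>,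
  \<open>y = n - i\<close> and \<open>C\<close>, \<open>D\<close> the central binomial coefficients
  there. The factors 2(2x+1)/(x+1) and 2(2y+1)/(y+1) are ratios of successive ones.\<close>

lemma catalan_telescoping_identity:
  "1 / (x + 1) * C * (1 / (y + 1) * D) =
       2 * (2 * x + 1) / (x + 1) * C * D * (2 * (x + 1) - (x + y + 1)) / (2 * (x + y + 1) * (x + y + 2))
       - C * (2 * (2 * y + 1) / (y + 1) * D) * (2 * x - (x + y + 1)) / (2 * (x + y + 1) * (x + y + 2))"
  if "x + 1 \<noteq> 0" "y + 1 \<noteq> 0" "x + y + 1 \<noteq> 0" "x + y + 2 \<noteq> 0"
  for x y C D :: real
proof -
  define S where "S = (x + y + 1) * (x + y + 2)"
  have S: "S \<noteq> 0" "2 * (x + y + 1) * (x + y + 2) = 2 * S" using that by (auto simp: S_def)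
  have K: "(2 * x + 1) * (x + 1 - y) * (y + 1) - (2 * y + 1) * (x - y - 1) * (x + 1) = S"
    unfolding S_def by algebra
  have "2 * (2 * x + 1) / (x + 1) * C * D * (2 * (x + 1) - (x + y + 1)) / (2 * S)
       - C * (2 * (2 * y + 1) / (y + 1) * D) * (2 * x - (x + y + 1)) / (2 * S)
     = C * D * ((2 * x + 1) * (x + 1 - y) / (x + 1) - (2 * y + 1) * (x - y - 1) / (y + 1)) / S"
  proof -
    have "2 * a / X * C * D * b / (2 * S) - C * (2 * c / Y * D) * d / (2 * S)
      = C * D * (a * b / X - c * d / Y) / S" for a b c d X Y
      by (simp add: diff_divide_distrib right_diff_distrib ac_simps)
    moreover have "2 * (x + 1) - (x + y + 1) = x + 1 - y" "2 * x - (x + y + 1) = x - y - 1"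
      by simp_all
    ultimately show ?thesis by metis
  qed
  also have "\<dots> = C * D * (((2 * x + 1) * (x + 1 - y) * (y + 1) - (2 * y + 1) * (x - y - 1) * (x + 1)) / ((x + 1) * (y + 1))) / S"
    using that(1,2) by (subst diff_frac_eq) auto
  also have "\<dots> = 1 / (x + 1) * C * (1 / (y + 1) * D)"
    unfolding K using S(1) by simp
  finally show ?thesis unfolding S(2) by simp
qed

lemma catalan_Suc: "catalan (Suc n) = (\<Sum>i\<le>n. catalan i * catalan (n - i))"
proof -
  define c :: "nat \<Rightarrow> real" where "c k = real ((2 * k) choose k)" for k
  \<comment> \<open>A discrete antiderivative of the convolution. It is antisymmetric under
    replacing \<open>j\<close> by \<open>Suc n - j\<close>, so the telescoped sum is
    \<open>2 * g (Suc n)\<close>.\<close>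
  define g where "g j = c j * c (Suc n - j) * (2 * real j - (real n + 1))
    / (2 * (real n + 1) * (real n + 2))" for j
  have c_Suc: "c (Suc k) = 2 * (2 * real k + 1) / (real k + 1) * c k" for k
    using central_binomial_Suc[of k] unfolding c_def by (simp add: field_simps)
  have "catalan i * catalan (n - i) = g (Suc i) - g i" if "i \<le> n" for i
  proof -
    obtain m where n: "n = i + m"
      using \<open>i \<le> n\<close> le_Suc_ex by blast
    have 1: "Suc n - i = Suc m" "Suc n - Suc i = m" "n - i = m"
      using n by auto
    have nz: "real i + 1 \<noteq> 0" "real m + 1 \<noteq> 0" "real i + real m + 1 \<noteq> 0" "real i + real m + 2 \<noteq> 0"
      by linarith+
    show ?thesis
      unfolding g_def 1 c_Suc catalan_def c_def[symmetric]
      using catalan_telescoping_identity[OF nz, of "c i" "c m"] unfolding n by (simp add: add.commute)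
  qed
  then have "(\<Sum>i\<le>n. catalan i * catalan (n - i)) = (\<Sum>i<Suc n. g (Suc i) - g i)"
    unfolding lessThan_Suc_atMost by (intro sum.cong) auto
  also have "\<dots> = g (Suc n) - g 0"
    by (rule sum_lessThan_telescope)
  also have "\<dots> = catalan (Suc n)"
  proof -
    have "c 0 = 1" by (simp add: c_def)
    then show ?thesis
      unfolding g_def catalan_def c_def[symmetric] by (simp add: divide_simps) (simp add: algebra_simps)
  qed
  finally show ?thesis by simp
qed

section \<open>Joining sets of lists at a separator\<close>

definition slice :: "'a list set \<Rightarrow> nat \<Rightarrow> 'a list set" where
  "slice X m = {l \<in> X. length l = m}"

definition join :: "'a list set \<Rightarrow> 'a \<Rightarrow> 'a list set \<Rightarrow> 'a list set" where
  "join X s Y = {l @ s # r | l r. l \<in> X \<and> r \<in> Y}"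

definition counted :: "'a list set \<Rightarrow> nat \<Rightarrow> real \<Rightarrow> bool" where
  "counted X m c \<longleftrightarrow> finite (slice X m) \<and> real (card (slice X m)) = c"

lemma split_first_unique:
  assumes "l @ s # r = l' @ s # r'" "s \<notin> set l" "s \<notin> set l'"
  shows "l = l' \<and> r = r'"
  using assms
proof (induction l arbitrary: l')
  case Nil
  then show ?case by (cases l') auto
next
  case (Cons a l)
  then show ?case by (cases l') auto
qed

text \<open>The separator takes one position, hence \<open>Suc m\<close>. Being absent from the left
  part, it is found again as the first \<open>s\<close>, so the pair is determined and the counts
  convolve.\<close>

lemma counted_join:
  assumes X: "\<And>i. i \<le> m \<Longrightarrow> counted X i (f i)" and Y: "\<And>i. i \<le> m \<Longrightarrow> counted Y i (g i)"
    and s: "\<And>l. l \<in> X \<Longrightarrow> s \<notin> set l"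
  shows "counted (join X s Y) (Suc m) (\<Sum>i\<le>m. f i * g (m - i))"
proof -
  let ?P = "SIGMA i:{..m}. slice X i \<times> slice Y (m - i)"
  let ?h = "\<lambda>(i :: nat, l, r). l @ s # r"
  have img: "slice (join X s Y) (Suc m) = ?h ` ?P"
  proof (intro subset_antisym subsetI)
    fix x assume "x \<in> slice (join X s Y) (Suc m)"
    then obtain l r where x: "x = l @ s # r" "l \<in> X" "r \<in> Y" "length l + length r = m"
      by (auto simp: slice_def join_def)
    then have "(length l, l, r) \<in> ?P"
      by (auto simp: slice_def)
    then show "x \<in> ?h ` ?P"
      using x(1) by (intro image_eqI[of _ _ "(length l, l, r)"]) simp_all
  qed (auto simp: slice_def join_def)
  have inj: "inj_on ?h ?P"
  proof (rule inj_onI)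
    fix x y assume xy: "x \<in> ?P" "y \<in> ?P" "?h x = ?h y"
    obtain i l r j l' r' where "x = (i, l, r)" "y = (j, l', r')"
      by (metis prod_cases3)
    then show "x = y"
      using xy split_first_unique[of l s r l' r'] s[of l] s[of l'] by (auto simp: slice_def)
  qed
  have fin: "finite ?P"
    using X Y unfolding counted_def by auto
  have "real (card (slice (join X s Y) (Suc m))) = real (card ?P)"
    unfolding img by (simp add: card_image[OF inj])
  also have "\<dots> = (\<Sum>i\<le>m. f i * g (m - i))"
    using X Y unfolding counted_def by (subst card_SigmaI) (auto simp: card_cartesian_product)
  finally show ?thesis
    unfolding counted_def img using fin by auto
qed

lemma counted_join_0: "counted (join X s Y) 0 0"
proof -
  have "slice (join X s Y) 0 = {}"
    by (auto simp: slice_def join_def)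
  then show ?thesis
    by (simp add: counted_def)
qed

lemma counted_union:
  assumes "counted X m c" "counted Y m d" "X \<inter> Y = {}"
  shows "counted (X \<union> Y) m (c + d)"
proof -
  have "slice (X \<union> Y) m = slice X m \<union> slice Y m" "slice X m \<inter> slice Y m = {}"
    using assms(3) by (auto simp: slice_def)
  then show ?thesis
    using assms by (simp add: counted_def card_Un_disjoint)
qed

section \<open>Mediant insertions\<close>

text \<open>In-order reading of a binary tree: the root is the sum of the ends of the gap, and the
  subtrees fill the two gaps it creates, as in the Stern-Brocot construction.\<close>

inductive mediant_list :: "nat \<Rightarrow> nat \<Rightarrow> nat list \<Rightarrow> bool" where
  Nil: "mediant_list p q []"
| node: "mediant_list p (p + q) l \<Longrightarrow> mediant_list (p + q) q r \<Longrightarrow> mediant_list p q (l @ (p + q) # r)"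

definition mediants :: "nat \<Rightarrow> nat \<Rightarrow> nat list set" where
  "mediants p q = {l. mediant_list p q l}"

lemma mediants_Nil: "[] \<in> mediants p q"
  by (simp add: mediants_def mediant_list.Nil)

lemma mediants_node:
  "l \<in> mediants p (p + q) \<Longrightarrow> r \<in> mediants (p + q) q \<Longrightarrow> l @ (p + q) # r \<in> mediants p q"
  by (simp add: mediants_def mediant_list.node)

lemma mediants_induct [consumes 1, case_names Nil node]:
  assumes "l \<in> mediants p q"
    and "\<And>p q. P p q []"
    and "\<And>p q l r. l \<in> mediants p (p + q) \<Longrightarrow> P p (p + q) l \<Longrightarrow> r \<in> mediants (p + q) q \<Longrightarrow>
      P (p + q) q r \<Longrightarrow> P p q (l @ (p + q) # r)"
  shows "P p q l"
  using assms(1) unfolding mediants_def mem_Collect_eq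
  by (induction rule: mediant_list.induct) (auto intro: assms(2,3) simp: mediants_def)

text \<open>The gaps created inside have end sums at least as large. This bound later identifies
  separators and keeps families disjoint.\<close>

lemma mediants_ge:
  assumes "l \<in> mediants p q" "x \<in> set l"
  shows "p + q \<le> x"
  using assms by (induction arbitrary: x rule: mediants_induct) force+

lemma mediants_root_notin:
  assumes "l \<in> mediants p s" "0 < p"
  shows "s \<notin> set l"
  using mediants_ge[OF assms(1), of s] assms(2) by auto

lemma mediants_unfold: "mediants p q = insert [] (join (mediants p (p + q)) (p + q) (mediants (p + q) q))"
  unfolding join_def by (auto simp: mediants_def intro: mediant_list.intros elim: mediant_list.cases)

text \<open>Splitting at the root gives the Catalan recurrence. As \<open>0 < p\<close>, all entries
  left of the root exceed it; for \<open>q = 0\<close> its value may recur to the right.\<close>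

lemma counted_mediants:
  assumes "0 < p"
  shows "counted (mediants p q) m (catalan m)"
  using assms
proof (induction m arbitrary: p q rule: less_induct)
  case (less m)
  show ?case
  proof (cases m)
    case 0
    have "slice (mediants p q) 0 = {[]}"
      unfolding slice_def by (auto intro: mediants_Nil)
    then show ?thesis
      using 0 by (simp add: counted_def catalan_def)
  next
    case (Suc k)
    have "counted (join (mediants p (p + q)) (p + q) (mediants (p + q) q))
      (Suc k) (\<Sum>i\<le>k. catalan i * catalan (k - i))"
      using less Suc mediants_root_notin by (intro counted_join) auto
    moreover have "slice (mediants p q) (Suc k)
      = slice (join (mediants p (p + q)) (p + q) (mediants (p + q) q)) (Suc k)"
      by (subst mediants_unfold) (auto simp: slice_def)
    ultimately show ?thesis
      unfolding Suc counted_def catalan_Suc by simp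
  qed
qed

section \<open>Closure under inserting sums into gaps\<close>

definition insert_closed :: "nat \<Rightarrow> nat \<Rightarrow> nat list set \<Rightarrow> bool" where
  "insert_closed p q X \<longleftrightarrow>
     (\<forall>u v. u @ v \<in> X \<longrightarrow> u @ (last (p # u) + hd (v @ [q])) # v \<in> X)"

lemma joinI: "l \<in> X \<Longrightarrow> r \<in> Y \<Longrightarrow> l @ s # r \<in> join X s Y"
  by (auto simp: join_def)

text \<open>A gap lies on one side of \<open>s\<close>; the one just before \<open>s\<close> is the
  first case with \<open>w = []\<close>.\<close>

lemma append_eq_append_Cons_cases:
  assumes "u @ v = l @ s # r"
  obtains w where "l = u @ w" "v = w @ s # r" | w where "u = l @ s # w" "r = w @ v"
proof -
  from assms obtain us where us: "u = l @ us \<and> us @ v = s # r \<or> u @ us = l \<and> v = us @ s # r"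
    by (auto simp: append_eq_append_conv2)
  show thesis
  proof (cases "u @ us = l \<and> v = us @ s # r")
    case True
    then show thesis using that(1) by blast
  next
    case False
    then show thesis using us that(1)[of "[]"] that(2) by (cases us) auto
  qed
qed

text \<open>The separator serves as an end of both lists, so each insertion happens within one of
  them.\<close>

lemma insert_closed_join:
  assumes "insert_closed p s X" "insert_closed s q Y"
  shows "insert_closed p q (join X s Y)"
  unfolding insert_closed_def
proof (intro allI impI)
  fix u v assume "u @ v \<in> join X s Y"
  then obtain l r where lr: "u @ v = l @ s # r" "l \<in> X" "r \<in> Y"
    by (auto simp: join_def)
  from lr(1) consider w where "l = u @ w" "v = w @ s # r" | w where "u = l @ s # w" "r = w @ v"
    by (rule append_eq_append_Cons_cases)
  then show "u @ (last (p # u) + hd (v @ [q])) # v \<in> join X s Y"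
  proof cases
    case 1
    have "u @ (last (p # u) + hd (w @ [s])) # w \<in> X"
      using assms(1) lr(2) 1(1) by (auto simp: insert_closed_def)
    moreover have "hd (v @ [q]) = hd (w @ [s])"
      using 1(2) by (cases w) auto
    ultimately show ?thesis
      using joinI[OF _ lr(3)] 1(2) by (metis append_Cons append_assoc)
  next
    case 2
    have "w @ (last (s # w) + hd (v @ [q])) # v \<in> Y"
      using assms(2) lr(3) 2(2) by (auto simp: insert_closed_def)
    moreover have "last (p # u) = last (s # w)"
      using 2(1) by auto
    ultimately show ?thesis
      using joinI[OF lr(2)] 2(1) by (metis append_Cons append_assoc)
  qed
qed

lemma insert_closed_union:
  "insert_closed p q X \<Longrightarrow> insert_closed p q Y \<Longrightarrow> insert_closed p q (X \<union> Y)"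
  by (auto simp: insert_closed_def)

text \<open>Inserting at a gap hangs a new leaf at the corresponding empty place of the
  tree.\<close>

lemma insert_closed_mediants: "insert_closed p q (mediants p q)"
proof -
  have "u @ (last (p # u) + hd (v @ [q])) # v \<in> mediants p q" if "u @ v \<in> mediants p q" for u v
    using that
  proof (induction "u @ v" arbitrary: u v rule: mediants_induct)
    case (Nil p q)
    then show ?case
      using mediants_node[OF mediants_Nil mediants_Nil, of p q] by simp
  next
    case (node p q l r)
    from node.hyps(5)[symmetric] consider w where "l = u @ w" "v = w @ (p + q) # r"
      | w where "u = l @ (p + q) # w" "r = w @ v"
      by (rule append_eq_append_Cons_cases)
    then show ?case
    proof cases
      case 1
      have "hd (v @ [q]) = hd (w @ [p + q])"
        using 1(2) by (cases w) auto
      then show ?thesis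
        using mediants_node[OF node.hyps(2)[OF 1(1)] node.hyps(3)] 1(2) by simp
    next
      case 2
      have "last (p # u) = last ((p + q) # w)"
        using 2(1) by auto
      then show ?thesis
        using mediants_node[OF node.hyps(1) node.hyps(4)[OF 2(2)]] 2(1) by simp
    qed
  qed
  then show ?thesis
    by (simp add: insert_closed_def)
qed

section \<open>Divisibility chains\<close>

text \<open>Only interior entries are constrained, which admits a closing 0; their positivity rules
  out \<open>0 dvd 0\<close>.\<close>

fun chain :: "nat list \<Rightarrow> bool" where
  "chain (a # b # c # r) \<longleftrightarrow> 0 < b \<and> b dvd a + c \<and> chain (b # c # r)"
| "chain _ \<longleftrightarrow> True"

lemma chain_append:
  "chain (p # l @ s # r @ [q]) \<longleftrightarrow>
     chain (p # l @ [s]) \<and> chain (s # r @ [q]) \<and> 0 < s \<and> s dvd last (p # l) + hd (r @ [q])"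
proof (induction l arbitrary: p)
  case Nil
  then show ?case by (cases r) auto
next
  case (Cons a l)
  then show ?case by (cases l) auto
qed

lemma cong_imp_dvd_add:
  fixes a b c d s :: nat
  assumes "[a = c] (mod s)" "[b = d] (mod s)" "s dvd c + d"
  shows "s dvd a + b"
  using cong_add[OF assms(1,2)] assms(3) by (simp add: cong_dvd_iff)

text \<open>The congruences strengthen the induction: the neighbors of the root
  \<open>s = p + q\<close> are congruent to \<open>p\<close> and \<open>q\<close> modulo
  \<open>s\<close>, so \<open>s\<close> divides their sum. For \<open>q = 0\<close> congruence is
  equality and fixes the last entry.\<close>

lemma mediants_chain:
  assumes "l \<in> mediants p q" "0 < p"
  shows "chain (p # l @ [q])" "[last (p # l) = p] (mod q)" "[hd (l @ [q]) = q] (mod p)"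
proof -
  have "chain (p # l @ [q]) \<and> [last (p # l) = p] (mod q) \<and> [hd (l @ [q]) = q] (mod p)"
    using assms
  proof (induction rule: mediants_induct)
    case (Nil p q)
    then show ?case by simp
  next
    case (node p q l r)
    let ?s = "p + q"
    have IH: "chain (p # l @ [?s])" "[last (p # l) = p] (mod ?s)" "[hd (l @ [?s]) = ?s] (mod p)"
      "chain (?s # r @ [q])" "[last (?s # r) = ?s] (mod q)" "[hd (r @ [q]) = q] (mod ?s)"
      using node.IH node.prems by auto
    have 1: "last (p # l @ ?s # r) = last (?s # r)" "hd ((l @ ?s # r) @ [q]) = hd (l @ [?s])"
      by (simp, cases l, auto)
    have "?s dvd last (p # l) + hd (r @ [q])"
      using cong_imp_dvd_add[OF IH(2,6)] by simp
    moreover have "[last (?s # r) = p] (mod q)" "[hd (l @ [?s]) = q] (mod p)"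
      using IH(3,5) by (auto simp: cong_def)
    ultimately show ?case
      unfolding 1 using IH(1,4) chain_append[of p l ?s r q] node.prems by auto
  qed
  then show "chain (p # l @ [q])" "[last (p # l) = p] (mod q)" "[hd (l @ [q]) = q] (mod p)"
    by auto
qed

text \<open>Only conditions at the neighbors of the deleted entry change. Such a neighbor
  \<open>b\<close> divided a sum containing the deleted entry, hence containing \<open>b\<close>
  itself; dropping that summand keeps divisibility.\<close>

lemma chain_remove:
  assumes "chain (p # u @ (last (p # u) + hd (v @ [q])) # v @ [q])"
  shows "chain (p # u @ v @ [q])"
proof -
  have *: "chain (p # u @ v @ [q])"
    if "chain (p # u @ s # v @ [q])" "s = last (p # u) + hd (v @ [q])" for s
    using that
  proof (induction u arbitrary: p)
    case Nil
    then show ?case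
    proof (cases v)
      case (Cons c v')
      have "p + c + x = c + (p + x)" for x
        by simp
      then have "c dvd p + x" if "c dvd p + c + x" for x
        using that by (metis dvd_add_right_iff dvd_refl)
      then show ?thesis
        using Nil Cons by (cases v') auto
    qed auto
  next
    case (Cons b u)
    have IH: "chain (b # u @ v @ [q])"
      using Cons.IH[of b] Cons.prems by (cases u) auto
    show ?case
    proof (cases u)
      case Nil
      have "0 < b" "b dvd p + (b + hd (v @ [q]))"
        using Cons.prems Nil by auto
      moreover have "b dvd p + hd (v @ [q])"
        using calculation(2) by (metis add.left_commute dvd_add_right_iff dvd_refl)
      ultimately show ?thesis
        using IH Nil by (cases v) auto
    next
      case (Cons c u')
      then show ?thesis
        using IH Cons.prems by auto
    qed
  qed
  show ?thesis
    using *[OF assms refl] .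
qed

section \<open>Reduction to irreducible chains\<close>

definition irreducible_chain :: "nat \<Rightarrow> nat \<Rightarrow> nat list \<Rightarrow> bool" where
  "irreducible_chain p q l \<longleftrightarrow> (\<forall>u v. l \<noteq> u @ (last (p # u) + hd (v @ [q])) # v)"

lemma irreducible_chain_Cons:
  assumes "irreducible_chain p q (b # l)"
  shows "irreducible_chain b q l" "b \<noteq> p + hd (l @ [q])"
proof -
  show "b \<noteq> p + hd (l @ [q])"
    using assms unfolding irreducible_chain_def by (metis append_Nil last.simps)
  show "irreducible_chain b q l"
    unfolding irreducible_chain_def
  proof (intro allI notI)
    fix u v assume "l = u @ (last (b # u) + hd (v @ [q])) # v"
    then have "b # l = (b # u) @ (last (p # b # u) + hd (v @ [q])) # v"
      by simp
    then show False
      using assms unfolding irreducible_chain_def by blast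
  qed
qed

text \<open>An irreducible chain is convex, so the final drop from 1 to 0 forces it to decrease throughout.\<close>

lemma irreducible_chain_hd_less:
  assumes "chain (p # l @ [0])" "last (p # l) = 1" "0 < p" "irreducible_chain p 0 l"
  shows "hd (l @ [0]) < p"
  using assms
proof (induction l arbitrary: p)
  case Nil
  then show ?case by simp
next
  case (Cons b l)
  let ?h = "hd (l @ [0])"
  have b: "0 < b" "b dvd p + ?h" "chain (b # l @ [0])"
    using Cons.prems(1) by (cases l; simp)+
  have "?h < b"
    using Cons.IH[OF b(3)] Cons.prems(2) b(1) irreducible_chain_Cons[OF Cons.prems(4)] by auto
  moreover have "b \<noteq> p + ?h"
    using irreducible_chain_Cons[OF Cons.prems(4)] by simp
  moreover obtain k where k: "p + ?h = b * k"
    using b(2) by blast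
  \<comment> \<open>\<open>k = 0\<close> contradicts \<open>0 < p\<close> and \<open>k = 1\<close>
    contradicts irreducibility. So \<open>b * 2 \<le> p + ?h\<close>, and \<open>?h < b\<close>
    yields \<open>b < p\<close>.\<close>
  moreover have "k \<noteq> 0" "k \<noteq> 1"
    using k Cons.prems(3) \<open>b \<noteq> p + ?h\<close> by (intro notI; simp)+
  then have "b * 2 \<le> p + ?h"
    unfolding k by simp
  ultimately have "b < p" by linarith
  then show ?case by simp
qed

text \<open>With \<open>last (x # l)\<close> the empty list belongs exactly when
  \<open>x = 1\<close>; the closing 0 stays outside the list.\<close>

definition unit_chains :: "nat \<Rightarrow> nat list set" where
  "unit_chains x = {l. chain (x # l @ [0]) \<and> last (x # l) = 1}"

text \<open>Induction on length: removing a reducible entry leaves a shorter unit chain, which lies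
  in \<open>X\<close>, and closure puts the entry back.\<close>

lemma unit_chains_eqI:
  assumes "0 < x" "insert_closed x 0 X"
    and irred: "\<And>l. l \<in> unit_chains x \<Longrightarrow> irreducible_chain x 0 l \<Longrightarrow> l \<in> X"
    and "X \<subseteq> unit_chains x"
  shows "unit_chains x = X"
proof -
  have "l \<in> X" if "l \<in> unit_chains x" for l
    using that
  proof (induction l rule: length_induct)
    case (1 l)
    show ?case
    proof (cases "irreducible_chain x 0 l")
      case True
      then show ?thesis using irred 1 by blast
    next
      case False
      then obtain u v where l: "l = u @ (last (x # u) + hd (v @ [0])) # v"
        unfolding irreducible_chain_def by blast
      have "chain (x # u @ v @ [0])"
        using chain_remove[of x u v 0] 1(2) l by (simp add: unit_chains_def)
      \<comment> \<open>If the last entry was removed, its right neighbor was 0, so its left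
        neighbor is also 1.\<close>
      moreover have "last (x # u @ v) = 1"
        using 1(2) l by (cases "v = []") (auto simp: unit_chains_def)
      ultimately have "u @ v \<in> X"
        using 1(1) l by (auto simp: unit_chains_def)
      then show ?thesis
        using assms(2) unfolding insert_closed_def l by blast
    qed
  qed
  then show ?thesis
    using assms(4) by blast
qed

lemma irreducible_unit_chains_Cons:
  assumes "b # l \<in> unit_chains x" "irreducible_chain x 0 (b # l)" "0 < x"
  shows "0 < b" "b < x" "b dvd x + hd (l @ [0])" "hd (l @ [0]) < b"
    "l \<in> unit_chains b" "irreducible_chain b 0 l"
proof -
  show irr: "irreducible_chain b 0 l"
    using irreducible_chain_Cons assms(2) by blast
  show b: "0 < b" "b dvd x + hd (l @ [0])" and l: "l \<in> unit_chains b"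
    using assms(1) by (cases l; simp add: unit_chains_def)+
  show "b < x"
    using irreducible_chain_hd_less[of x "b # l"] assms by (simp add: unit_chains_def)
  show "hd (l @ [0]) < b"
    using irreducible_chain_hd_less[of b l] l b(1) irr by (simp add: unit_chains_def)
qed

lemma irreducible_unit_chains_1: "l \<in> unit_chains 1 \<Longrightarrow> irreducible_chain 1 0 l \<Longrightarrow> l = []"
  using irreducible_unit_chains_Cons(1,2)[of _ _ 1] by (cases l) fastforce+

lemma irreducible_unit_chains_2:
  assumes "l \<in> unit_chains 2" "irreducible_chain 2 0 l"
  shows "l = [1]"
proof (cases l)
  case Nil
  then show ?thesis using assms(1) by (simp add: unit_chains_def)
next
  case (Cons b r)
  note r = irreducible_unit_chains_Cons[OF assms[unfolded Cons]]
  then have "b = 1" by simp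
  then show ?thesis
    using irreducible_unit_chains_1 r(5,6) Cons by simp
qed

text \<open>The chain decreases from 4. A first entry 2 would be followed by 1, but 2 does not
  divide 5; a first entry 3 forces 2 next.\<close>

lemma irreducible_unit_chains_4:
  assumes "l \<in> unit_chains 4" "irreducible_chain 4 0 l"
  shows "l = [1] \<or> l = [3, 2, 1]"
proof (cases l)
  case Nil
  then show ?thesis using assms(1) by (simp add: unit_chains_def)
next
  case (Cons b r)
  note r = irreducible_unit_chains_Cons[OF assms[unfolded Cons]]
  then consider "b = 1" | "b = 2" | "b = 3" by force
  then show ?thesis
  proof cases
    case 1
    then show ?thesis
      using irreducible_unit_chains_1 r(5,6) Cons by simp
  next
    case 2
    then have "r = [1]"
      using irreducible_unit_chains_2 r(5,6) by simp
    then have "(2::nat) dvd 5"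
      using r(3) 2 by simp
    then show ?thesis by presburger
  next
    case 3
    let ?h = "hd (r @ [0])"
    have "?h < 3" "3 dvd 4 + ?h"
      using r(3,4) 3 by simp_all
    then have "?h = 2" by presburger
    then obtain r' where r': "r = 2 # r'"
      by (cases r) auto
    have "r' \<in> unit_chains 2" "irreducible_chain 2 0 r'"
      using irreducible_unit_chains_Cons(5,6)[of 2 r' 3] r(5,6) r' 3 by simp_all
    then show ?thesis
      using irreducible_unit_chains_2 r' 3 Cons by blast
  qed
qed

section \<open>Unit chains as refinements of irreducible ones\<close>

lemma mediants_last_1: "r \<in> mediants 1 0 \<Longrightarrow> last (1 # r) = 1"
  using mediants_chain(2)[of r 1 0] by (simp add: cong_0)

text \<open>The neighbors of \<open>s\<close> are congruent to \<open>p\<close> and \<open>q\<close>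
  modulo \<open>s\<close>, so divisibility in \<open>p, s, q\<close> survives all
  insertions.\<close>

lemma join_mediants_chain:
  assumes "0 < p" "0 < s" "s dvd p + q" "l \<in> join (mediants p s) s (mediants s q)"
  shows "chain (p # l @ [q])"
proof -
  obtain u v where uv: "l = u @ s # v" "u \<in> mediants p s" "v \<in> mediants s q"
    using assms(4) by (auto simp: join_def)
  have "s dvd last (p # u) + hd (v @ [q])"
    using cong_imp_dvd_add[OF mediants_chain(2)[OF uv(2)] mediants_chain(3)[OF uv(3)]] assms by simp
  then show ?thesis
    using mediants_chain(1)[OF uv(2)] mediants_chain(1)[OF uv(3)] assms(1,2) uv(1)
      chain_append[of p u s v q] by simp
qed

lemma join_mediants_1_subset_unit_chains:
  assumes "0 < p"
  shows "join (mediants p 1) 1 (mediants 1 0) \<subseteq> unit_chains p"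
proof
  fix l assume l: "l \<in> join (mediants p 1) 1 (mediants 1 0)"
  then have "last (p # l) = 1"
    using mediants_last_1 by (auto simp: join_def)
  then show "l \<in> unit_chains p"
    using join_mediants_chain[OF assms _ _ l] by (simp add: unit_chains_def)
qed

lemma unit_chains_1: "unit_chains 1 = mediants 1 0"
proof (rule unit_chains_eqI)
  show "mediants 1 0 \<subseteq> unit_chains 1"
  proof
    fix l :: "nat list" assume "l \<in> mediants 1 0"
    then show "l \<in> unit_chains 1"
      using mediants_chain(1)[of l 1 0] mediants_last_1[of l] by (simp add: unit_chains_def)
  qed
  show "l \<in> mediants 1 0" if "l \<in> unit_chains 1" "irreducible_chain 1 0 l" for l
    using irreducible_unit_chains_1[OF that] mediants_Nil by simp
qed (simp_all add: insert_closed_mediants)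

lemma join_Nil: "[] \<in> X \<Longrightarrow> [] \<in> Y \<Longrightarrow> [s] \<in> join X s Y"
  using joinI[of "[]" X "[]" Y s] by simp

lemma unit_chains_2: "unit_chains 2 = join (mediants 2 1) 1 (mediants 1 0)"
proof (rule unit_chains_eqI)
  show "l \<in> join (mediants 2 1) 1 (mediants 1 0)" if "l \<in> unit_chains 2" "irreducible_chain 2 0 l" for l
    using irreducible_unit_chains_2[OF that] by (simp add: join_Nil mediants_Nil)
  show "join (mediants 2 1) 1 (mediants 1 0) \<subseteq> unit_chains 2"
    by (rule join_mediants_1_subset_unit_chains) simp
qed (simp_all add: insert_closed_mediants insert_closed_join)

text \<open>The two sets refine 4, 1, 0 and 4, 3, 2, 1, 0. The latter is cut at 2 into halves with
  one separator each.\<close>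

lemma unit_chains_4:
  "unit_chains 4 = join (mediants 4 1) 1 (mediants 1 0) \<union>
     join (join (mediants 4 3) 3 (mediants 3 2)) 2 (join (mediants 2 1) 1 (mediants 1 0))"
    (is "_ = ?X \<union> join ?Y 2 ?Z")
proof (rule unit_chains_eqI)
  show "insert_closed 4 0 (?X \<union> join ?Y 2 ?Z)"
    by (intro insert_closed_union insert_closed_join insert_closed_mediants)
  show "l \<in> ?X \<union> join ?Y 2 ?Z" if "l \<in> unit_chains 4" "irreducible_chain 4 0 l" for l
  proof -
    have "[1] \<in> ?X" "[3] \<in> ?Y" "[1] \<in> ?Z"
      by (simp_all add: join_Nil mediants_Nil)
    moreover from this have "[3] @ 2 # [1] \<in> join ?Y 2 ?Z"
      by (intro joinI)
    ultimately show ?thesis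
      using irreducible_unit_chains_4[OF that] by auto
  qed
  have "l \<in> unit_chains 4" if "l \<in> join ?Y 2 ?Z" for l
  proof -
    obtain u v where uv: "l = u @ 2 # v" "u \<in> ?Y" "v \<in> ?Z"
      using \<open>l \<in> join ?Y 2 ?Z\<close> by (auto simp: join_def)
    \<comment> \<open>The condition at 2 involves only its neighbors, which come from the gaps 3, 2
      and 2, 1 and are congruent to 3 and 1 modulo 2.\<close>
    obtain u' where u': "last (4 # u) = last (3 # u')" "u' \<in> mediants 3 2"
      using uv(2) by (auto simp: join_def)
    obtain v' where v': "hd (v @ [0]) = hd (v' @ [1])" "v' \<in> mediants 2 1"
    proof -
      obtain w z where w: "v = w @ 1 # z" "w \<in> mediants 2 1"
        using uv(3) by (auto simp: join_def)
      then have "hd (v @ [0]) = hd (w @ [1])"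
        by (cases w) auto
      then show thesis using that w(2) by blast
    qed
    have "2 dvd last (4 # u) + hd (v @ [0])"
      using cong_imp_dvd_add[OF mediants_chain(2)[OF u'(2)] mediants_chain(3)[OF v'(2)]]
      unfolding u'(1) v'(1) by simp
    moreover have "chain (4 # u @ [2])"
      using join_mediants_chain[OF _ _ _ uv(2)] by simp
    moreover have v: "v \<in> unit_chains 2"
      using join_mediants_1_subset_unit_chains[of 2] uv(3) by auto
    ultimately show ?thesis
      using chain_append[of 4 u 2 v 0] unfolding uv(1) unit_chains_def by simp
  qed
  then show "?X \<union> join ?Y 2 ?Z \<subseteq> unit_chains 4"
    using join_mediants_1_subset_unit_chains[of 4] by auto
qed simp

section \<open>Counting unit chains\<close>

lemma counted_join_mediants:
  assumes "0 < p" "0 < s"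
  shows "counted (join (mediants p s) s (mediants s q)) n (if n = 0 then 0 else catalan n)"
proof (cases n)
  case 0
  then show ?thesis using counted_join_0 by simp
next
  \<comment> \<open>The separator uses one position, so the convolution of total length
    \<open>m\<close> gives exactly \<open>catalan (Suc m)\<close>.\<close>
  case (Suc m)
  then show ?thesis
    using counted_join[OF counted_mediants counted_mediants mediants_root_notin] assms catalan_Suc
    by simp
qed

lemma counted_unit_chains_1: "counted (unit_chains 1) n (catalan n)"
  unfolding unit_chains_1 by (rule counted_mediants) simp

lemma counted_unit_chains_2: "0 < n \<Longrightarrow> counted (unit_chains 2) n (catalan n)"
  unfolding unit_chains_2 using counted_join_mediants[of 2 1 0 n] by simp

text \<open>Both halves of the cut chain are nonempty, which removes the terms \<open>i = 0\<close>
  and \<open>i = m\<close>. Each equals \<open>catalan m\<close>, and they are distinct as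
  \<open>0 < m\<close>; this is where \<open>n \<ge> 2\<close> enters.\<close>

lemma sum_catalan_positive_indices:
  assumes "0 < m"
  shows "(\<Sum>i\<le>m. (if i = 0 then 0 else catalan i) * (if m - i = 0 then 0 else catalan (m - i)))
    = catalan (Suc m) - 2 * catalan m"
proof -
  have "catalan 0 = 1"
    by (simp add: catalan_def)
  then have "(if i = 0 then 0 else catalan i) * (if m - i = 0 then 0 else catalan (m - i)) =
    catalan i * catalan (m - i) - (if i = 0 then catalan m else 0) - (if i = m then catalan m else 0)"
    if "i \<le> m" for i
    using that assms by auto
  then show ?thesis
    by (simp add: catalan_Suc sum_subtractf)
qed

lemma counted_unit_chains_4:
  assumes "2 \<le> n"
  shows "counted (unit_chains 4) n (2 * catalan n - 2 * catalan (n - 1))"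
proof -
  let ?X = "join (mediants 4 1) 1 (mediants 1 0)"
  let ?Y = "join (mediants 4 3) 3 (mediants 3 2)"
  let ?Z = "join (mediants 2 1) 1 (mediants 1 0)"
  obtain m where n: "n = Suc m" "0 < m"
    using assms by (cases n) auto
  \<comment> \<open>Lists in \<open>?Y\<close> consist of 3 and numbers at least 5.\<close>
  have "2 \<notin> set l" if "l \<in> ?Y" for l
    using that mediants_ge[of _ 4 3 2] mediants_ge[of _ 3 2 2] by (auto simp: join_def)
  then have "counted (join ?Y 2 ?Z) n (catalan n - 2 * catalan m)"
    using counted_join[of m ?Y "\<lambda>i. if i = 0 then 0 else catalan i" ?Z
        "\<lambda>i. if i = 0 then 0 else catalan i" 2] counted_join_mediants
    unfolding n sum_catalan_positive_indices[OF n(2)] by simp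
  moreover have "counted ?X n (catalan n)"
    using counted_join_mediants[of 4 1 0 n] n by simp
  \<comment> \<open>Before the first 1, lists in \<open>?X\<close> have only entries at least 5,
    while the others contain 3.\<close>
  moreover have "?X \<inter> join ?Y 2 ?Z = {}"
  proof (intro equals0I)
    fix l assume "l \<in> ?X \<inter> join ?Y 2 ?Z"
    then have "l \<in> ?X" "l \<in> join ?Y 2 ?Z"
      by auto
    then obtain u v where u: "l = u @ 1 # v" "u \<in> mediants 4 1"
      by (auto simp: join_def)
    obtain w x y z where w: "l = (w @ 3 # x) @ 2 # y @ 1 # z" "w \<in> mediants 4 3"
      "x \<in> mediants 3 2" "y \<in> mediants 2 1"
      using \<open>l \<in> join ?Y 2 ?Z\<close> unfolding join_def by blast
    have "u @ 1 # v = (w @ 3 # x @ 2 # y) @ 1 # z"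
      using u(1) w(1) by simp
    moreover have "1 \<notin> set (w @ 3 # x @ 2 # y)" "1 \<notin> set u"
      using mediants_ge[OF w(2), of 1] mediants_ge[OF w(3), of 1] mediants_ge[OF w(4), of 1]
        mediants_ge[OF u(2), of 1] by auto
    ultimately have "u = w @ 3 # x @ 2 # y"
      using split_first_unique by metis
    then show False
      using mediants_ge[OF u(2), of 3] by simp
  qed
  ultimately have "counted (unit_chains 4) n (catalan n + (catalan n - 2 * catalan m))"
    unfolding unit_chains_4 by (intro counted_union)
  then show ?thesis
    by (simp add: n counted_def)
qed

section \<open>Chains and coprimality\<close>

text \<open>A common divisor of two consecutive entries divides the following one, and so travels to
  the end.\<close>

lemma chain_dvd_last:
  fixes d :: nat
  assumes "chain (p # l @ [0])" "d dvd p" "d dvd hd (l @ [0])"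
  shows "d dvd last (p # l)"
  using assms
proof (induction l arbitrary: p)
  case (Cons b l)
  have b: "b dvd p + hd (l @ [0])" "chain (b # l @ [0])"
    using Cons.prems(1) by (cases l; simp)+
  have "d dvd p + hd (l @ [0])"
    using b(1) Cons.prems(3) dvd_trans by auto
  then have "d dvd hd (l @ [0])"
    using Cons.prems(2) dvd_add_right_iff by blast
  then show ?case
    using Cons.IH[OF b(2)] Cons.prems(3) by simp
qed simp

text \<open>Divisibility propagates backwards, starting from the last entry and the closing
  0.\<close>

lemma chain_last_dvd:
  assumes "chain (p # l @ [0])" "x \<in> set (p # l)"
  shows "last (p # l) dvd x"
  using assms
proof (induction l arbitrary: p x)
  case (Cons b l)
  let ?e = "last (b # l)"
  have b: "b dvd p + hd (l @ [0])" "chain (b # l @ [0])"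
    using Cons.prems(1) by (cases l; simp)+
  have *: "?e dvd y" if "y \<in> set (b # l)" for y
    using Cons.IH[OF b(2) that] .
  have "?e dvd hd (l @ [0])"
    using * by (cases l) auto
  moreover have "?e dvd p + hd (l @ [0])"
    using *[of b] b(1) dvd_trans by auto
  ultimately have "?e dvd p"
    using dvd_add_left_iff by blast
  then show ?case
    using Cons.prems(2) * by auto
qed simp

lemma chain_scale:
  assumes "0 < c"
  shows "chain (map ((*) c) l) \<longleftrightarrow> chain l"
proof (induction l rule: chain.induct)
  case (1 a b x r)
  have "c * b dvd c * a + c * x \<longleftrightarrow> b dvd a + x"
    using assms by (simp flip: distrib_left)
  then show ?case
    using 1 assms by auto
qed simp_all

lemma structure_chain_iff:
  assumes "l \<noteq> []"
  shows "Gcd (insert a (set l)) = 1 \<and> a dvd 2 * hd l \<and> chain (2 * a # l @ [0]) \<longleftrightarrow>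
    a = 1 \<and> l \<in> unit_chains 2 \<or> a = 2 \<and> l \<in> unit_chains 4 \<or> a = 1 \<and> l \<in> map ((*) 2) ` unit_chains 1"
    (is "?L \<longleftrightarrow> ?R")
proof
  assume L: ?L
  let ?e = "last l"
  have e: "?e dvd 2 * a" "\<And>x. x \<in> set l \<Longrightarrow> ?e dvd x"
    using chain_last_dvd[of "2 * a" l] L assms by auto
  \<comment> \<open>This gcd divides every label, hence is 1; then \<open>?e dvd 2 * a\<close>
    leaves \<open>?e dvd 2\<close>.\<close>
  have "gcd ?e a dvd x" if "x \<in> insert a (set l)" for x
    using that e(2) by (auto intro: dvd_trans[OF gcd_dvd1])
  then have "gcd ?e a dvd 1"
    using L Gcd_greatest by metis
  then have "coprime ?e a"
    by (simp add: coprime_iff_gcd_eq_1)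
  then have "?e dvd 2"
    using e(1) by (simp add: coprime_dvd_mult_left_iff)
  then have "?e \<le> 2" "?e \<noteq> 0"
    using dvd_imp_le[of ?e 2] dvd_pos_nat[of 2 ?e] by auto
  then consider "?e = 1" | "?e = 2" by linarith
  then show ?R
  proof cases
    case 1
    \<comment> \<open>A common divisor divides the first two terms \<open>2 * a\<close> and
      \<open>hd l\<close>, hence the last label 1.\<close>
    have "coprime a (hd l)"
    proof (rule coprimeI)
      fix d assume "d dvd a" "d dvd hd l"
      then show "is_unit d"
        using chain_dvd_last[of "2 * a" l d] L assms 1 by simp
    qed
    then have "a dvd 2"
      using L by (simp add: coprime_dvd_mult_left_iff)
    then have "a \<le> 2" "a \<noteq> 0"
      using dvd_imp_le[of a 2] dvd_pos_nat[of 2 a] by auto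
    then consider "a = 1" | "a = 2" by linarith
    then show ?thesis
      using L 1 assms by cases (auto simp: unit_chains_def)
  next
    case 2
    \<comment> \<open>All entries of \<open>l\<close> are even, and halving turns the first term
      into \<open>a\<close>. Being odd and dividing \<open>4 * hd k\<close>, \<open>a\<close>
      divides \<open>hd k\<close> and then the last entry 1.\<close>
    define k where "k = map (\<lambda>x. x div 2) l"
    have l: "l = map ((*) 2) k"
      using e(2) 2 by (auto simp: k_def map_idI comp_def intro!: map_idI[symmetric])
    have k: "k \<noteq> []" "chain (a # k @ [0])" "last k = 1"
      using L chain_scale[of 2 "a # k @ [0]"] 2 assms unfolding l by (auto simp: last_map)
    have "coprime a 2"
      using \<open>coprime ?e a\<close> 2 by (simp add: coprime_commute)
    moreover have "a dvd 2 * (2 * hd k)"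
      using L k(1) unfolding l by (simp add: hd_map)
    ultimately have "a dvd hd k"
      by (metis coprime_dvd_mult_right_iff)
    then have "a = 1"
      using chain_dvd_last[of a k a] k by simp
    then show ?thesis
      using k l by (auto simp: unit_chains_def)
  qed
next
  assume ?R
  then consider "a = 1" "l \<in> unit_chains 2" | "a = 2" "l \<in> unit_chains 4"
    | k where "a = 1" "l = map ((*) 2) k" "k \<in> unit_chains 1" by blast
  then show ?L
  proof cases
    case 2
    then have "last l = 1"
      using assms by (simp add: unit_chains_def)
    then have "1 \<in> set l"
      using assms last_in_set by metis
    then have "Gcd (insert a (set l)) dvd 1"
      by (intro Gcd_dvd) simp
    then show ?thesis
      using 2 by (simp add: unit_chains_def)
  next
    case 3
    then show ?thesis
      using chain_scale[of 2 "1 # k @ [0]"] by (simp add: unit_chains_def)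
  qed (simp add: unit_chains_def)
qed

section \<open>Labelings of the graph\<close>

lemma verts_P1: "verts (P1 n) = insert A1 (B ` {1..n})"
  by (simp add: P1_def)

lemma count_P1_A1_B: "count (edges (P1 n)) {A1, B j} = (if j = 1 then 2 else 0)"
  by (auto simp: P1_def count_image_mset' doubleton_eq_iff)

lemma count_P1_B_B:
  assumes "i \<in> {1..n}" "j \<in> {1..n}"
  shows "count (edges (P1 n)) {B i, B j} = (if j = i + 1 then 1 else 0) + (if i = j + 1 then 1 else 0)"
proof -
  have "count (edges (P1 n)) {B i, B j} = card {k \<in> {1..<n}. {B i, B j} = {B k, B (k + 1)}}"
    by (simp add: P1_def count_image_mset' doubleton_eq_iff)
  moreover have "{k \<in> {1..<n}. {B i, B j} = {B k, B (k + 1)}} =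
      (if j = i + 1 then {i} else if i = j + 1 then {j} else {})"
    using assms by (auto simp: doubleton_eq_iff)
  ultimately show ?thesis by simp
qed

lemma neighbor_sum_P1_A1:
  assumes "1 \<le> n"
  shows "neighbor_sum (P1 n) r A1 = 2 * r (B 1)"
proof -
  have "verts (P1 n) - {A1} = B ` {1..n}"
    by (auto simp: verts_P1)
  then have "neighbor_sum (P1 n) r A1 = (\<Sum>j\<in>{1..n}. (if j = 1 then 2 else 0) * r (B j))"
    unfolding neighbor_sum_def by (simp add: sum.reindex inj_on_def count_P1_A1_B)
  also have "\<dots> = (\<Sum>j\<in>{1..n}. if j = 1 then 2 * r (B 1) else 0)"
    by (intro sum.cong) auto
  finally show ?thesis
    using assms by simp
qed

lemma neighbor_sum_P1_B:
  assumes "i \<in> {1..n}"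
  shows "neighbor_sum (P1 n) r (B i) =
    (if i = 1 then 2 * r A1 else r (B (i - 1))) + (if i = n then 0 else r (B (i + 1)))"
proof -
  let ?I = "{1..n} - {i}"
  have v: "verts (P1 n) - {B i} = insert A1 (B ` ?I)"
    by (auto simp: verts_P1)
  have "count (edges (P1 n)) {B i, A1} = (if i = 1 then 2 else 0)"
    using count_P1_A1_B[of n i] by (simp add: insert_commute)
  then have "neighbor_sum (P1 n) r (B i) = (if i = 1 then 2 * r A1 else 0)
      + (\<Sum>j\<in>?I. count (edges (P1 n)) {B i, B j} * r (B j))"
    unfolding neighbor_sum_def v by (subst sum.insert) (auto simp: sum.reindex inj_on_def)
  \<comment> \<open>For \<open>i = 1\<close> the index \<open>i - 1\<close> is 0, outside
    \<open>{1..n}\<close>, so it contributes nothing.\<close>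
  also have "(\<Sum>j\<in>?I. count (edges (P1 n)) {B i, B j} * r (B j))
    = (\<Sum>j\<in>?I. (if j = i + 1 then r (B (i + 1)) else 0) + (if j = i - 1 then r (B (i - 1)) else 0))"
    using assms by (intro sum.cong refl, subst count_P1_B_B) auto
  also have "\<dots> = (\<Sum>j\<in>?I. if j = i + 1 then r (B (i + 1)) else 0)
      + (\<Sum>j\<in>?I. if j = i - 1 then r (B (i - 1)) else 0)"
    by (rule sum.distrib)
  also have "(\<Sum>j\<in>?I. if j = i + 1 then r (B (i + 1)) else 0) = (if i = n then 0 else r (B (i + 1)))"
    using assms by (subst sum.delta) auto
  also have "(\<Sum>j\<in>?I. if j = i - 1 then r (B (i - 1)) else 0) = (if i = 1 then 0 else r (B (i - 1)))"
    using assms by (subst sum.delta) auto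
  finally show ?thesis by simp
qed

text \<open>The value \<open>undefined\<close> off the vertices, including \<open>B 0\<close>, makes
  the function extensional.\<close>

definition labeling :: "nat \<times> nat list \<Rightarrow> path_vertex \<Rightarrow> nat" where
  "labeling = (\<lambda>(a, l) v. case v of A1 \<Rightarrow> a
     | B i \<Rightarrow> if 1 \<le> i \<and> i \<le> length l then l ! (i - 1) else undefined)"

lemma chain_iff_nth:
  "chain l \<longleftrightarrow> (\<forall>k. k + 2 < length l \<longrightarrow> 0 < l ! (k + 1) \<and> l ! (k + 1) dvd l ! k + l ! (k + 2))"
proof (induction l rule: chain.induct)
  case (1 a b c r)
  have "(\<forall>k. P k) \<longleftrightarrow> P 0 \<and> (\<forall>k. P (Suc k))" for P :: "nat \<Rightarrow> bool"
    using not0_implies_Suc by metis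
  from this[of "\<lambda>k. k + 2 < length (a # b # c # r) \<longrightarrow> 0 < (a # b # c # r) ! (k + 1) \<and>
      (a # b # c # r) ! (k + 1) dvd (a # b # c # r) ! k + (a # b # c # r) ! (k + 2)"]
  show ?case
    using 1 by simp
qed auto

text \<open>A zero label forces its neighbors to vanish, hence all labels.\<close>

lemma chain_iff_dvd_nth:
  fixes l :: "nat list"
  assumes "Gcd (insert a (set l)) = 1"
  shows "chain (2 * a # l @ [0]) \<longleftrightarrow>
    (\<forall>k < length l. l ! k dvd (2 * a # l @ [0]) ! k + (2 * a # l @ [0]) ! (k + 2))"
    (is "_ = (\<forall>k < _. _ dvd ?x ! k + _)")
proof
  assume R: "\<forall>k < length l. l ! k dvd ?x ! k + ?x ! (k + 2)"
  have x: "?x ! Suc k = l ! k" if "k < length l" for k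
    using that by (simp add: nth_append)
  have step: "?x ! k = 0 \<and> ?x ! (k + 2) = 0" if "k < length l" "?x ! Suc k = 0" for k
  proof -
    have "l ! k dvd ?x ! k + ?x ! (k + 2)"
      using R that(1) by blast
    moreover have "l ! k = 0"
      using x that by metis
    ultimately show ?thesis by simp
  qed
  have "0 < ?x ! Suc k" if "k < length l" for k
  proof (rule ccontr)
    assume "\<not> 0 < ?x ! Suc k"
    then have "?x ! Suc k = 0 \<and> ?x ! k = 0"
      using step that by simp
    \<comment> \<open>The zeros are traced back to the front; the next induction carries them
      through the whole list.\<close>
    then have 0: "?x ! Suc 0 = 0 \<and> ?x ! 0 = 0"
      using that
    proof (induction k)
      case (Suc k)
      then show ?case using step[of k] by simp
    qed simp
    have "?x ! Suc j = 0 \<and> ?x ! j = 0" if "j < length l" for j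
      using that
    proof (induction j)
      case (Suc j)
      then show ?case using step[of j] by simp
    qed (use 0 in simp)
    then have "\<forall>y\<in>set l. y = 0"
      using x by (metis in_set_conv_nth)
    moreover have "a = 0"
      using 0 by simp
    ultimately have "insert a (set l) \<subseteq> {0}"
      by auto
    then have "Gcd (insert a (set l)) = 0"
      using Gcd_0_iff by blast
    then show False
      using assms by (metis zero_neq_one)
  qed
  then show "chain ?x"
    unfolding chain_iff_nth using R x by simp
next
  assume "chain ?x"
  then show "\<forall>k < length l. l ! k dvd ?x ! k + ?x ! (k + 2)"
    unfolding chain_iff_nth by (simp add: nth_append)
qed

text \<open>The double edge puts \<open>2 * a\<close> before the first label, and the missing
  neighbor of the last vertex becomes 0. Gcd 1 supplies the positivity in
  \<open>chain\<close>.\<close>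

lemma labeling_structure_iff:
  assumes "length l = n" "1 \<le> n"
  shows "labeling (a, l) \<in> arithmetical_structures (P1 n) \<longleftrightarrow>
    Gcd (insert a (set l)) = 1 \<and> a dvd 2 * hd l \<and> chain (2 * a # l @ [0])"
proof -
  let ?r = "labeling (a, l)" and ?x = "2 * a # l @ [0]"
  have B: "?r (B (Suc k)) = l ! k" if "k < n" for k
    using that assms(1) by (simp add: labeling_def)
  have A: "?r A1 = a"
    by (simp add: labeling_def)
  have I: "{1..n} = Suc ` {..<n}"
    by (simp add: lessThan_atLeast0 image_Suc_atLeastLessThan atLeastLessThanSuc_atLeastAtMost)
  have "?r ` B ` {1..n} = (!) l ` {..<n}"
    unfolding I using B by (force simp: image_image)
  then have labels: "?r ` verts (P1 n) = insert a (set l)"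
    unfolding verts_P1 using A assms(1) by (simp add: set_conv_nth image_def) blast
  have ext: "?r \<in> verts (P1 n) \<rightarrow>\<^sub>E UNIV"
    using assms(1) by (auto simp: verts_P1 labeling_def PiE_def extensional_def split: path_vertex.split)
  have "neighbor_sum (P1 n) ?r (B (Suc k)) = ?x ! k + ?x ! (k + 2)" if "k < n" for k
  proof -
    have "(if Suc k = 1 then 2 * ?r A1 else ?r (B (Suc k - 1))) = ?x ! k"
      using that A B assms(1) by (cases k) (auto simp: nth_append)
    moreover have "(if Suc k = n then 0 else ?r (B (Suc k + 1))) = ?x ! (k + 2)"
      using that B[of "Suc k"] assms(1) by (auto simp: nth_append)
    ultimately show ?thesis
      using neighbor_sum_P1_B[of "Suc k" n ?r] that by simp
  qed
  moreover have "neighbor_sum (P1 n) ?r A1 = 2 * hd l"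
    using neighbor_sum_P1_A1[OF assms(2)] B[of 0] assms by (cases l) auto
  ultimately have "(\<forall>v \<in> verts (P1 n). ?r v dvd neighbor_sum (P1 n) ?r v) \<longleftrightarrow>
      a dvd 2 * hd l \<and> (\<forall>k < n. l ! k dvd ?x ! k + ?x ! (k + 2))"
    unfolding verts_P1 I using A B by (simp add: Ball_def[of "{..<n}"])
  then show ?thesis
    unfolding arithmetical_structures_def mem_Collect_eq labels
    using ext chain_iff_dvd_nth assms(1) by blast
qed

lemma labeling_surj:
  assumes "r \<in> arithmetical_structures (P1 n)"
  obtains a l where "length l = n" "r = labeling (a, l)"
proof -
  let ?l = "map (\<lambda>k. r (B (Suc k))) [0..<n]"
  have "r v = labeling (r A1, ?l) v" for v
    using assms by (cases v) (auto simp: arithmetical_structures_def verts_P1 labeling_def PiE_def extensional_def)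
  then have "r = labeling (r A1, ?l)"
    by (rule ext)
  then show thesis
    by (rule that[rotated]) simp
qed

text \<open>The length must be fixed: appending an entry equal to \<open>undefined\<close> would not
  change the function.\<close>

lemma inj_on_labeling: "inj_on labeling {(a, l). length l = n}"
proof (rule inj_onI, clarify)
  fix a b and l k :: "nat list"
  assume len: "n = length l" "length k = length l" and eq: "labeling (a, l) = labeling (b, k)"
  have "a = b"
    using fun_cong[OF eq, of A1] by (simp add: labeling_def)
  moreover have "l ! i = k ! i" if "i < length l" for i
    using fun_cong[OF eq, of "B (Suc i)"] that len by (simp add: labeling_def)
  ultimately show "a = b \<and> l = k"
    using len nth_equalityI by metis
qed

lemma arithmetical_structures_P1:
  assumes "1 \<le> n"
  shows "arithmetical_structures (P1 n) = labeling ` (Pair 1 ` slice (unit_chains 2) n \<union>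
    Pair 2 ` slice (unit_chains 4) n \<union> (\<lambda>l. (1, map ((*) 2) l)) ` slice (unit_chains 1) n)" (is "_ = labeling ` ?T")
proof -
  have T: "labeling (a, l) \<in> arithmetical_structures (P1 n) \<longleftrightarrow> (a, l) \<in> ?T" if "length l = n" for a l
  proof -
    have "l \<noteq> []"
      using that assms by auto
    then show ?thesis
      unfolding labeling_structure_iff[OF that assms] structure_chain_iff[OF \<open>l \<noteq> []\<close>]
      using that by (auto simp: slice_def)
  qed
  have "r \<in> labeling ` ?T" if r: "r \<in> arithmetical_structures (P1 n)" for r
  proof -
    obtain a l where al: "length l = n" "r = labeling (a, l)"
      by (rule labeling_surj[OF r])
    show ?thesis
      using r unfolding al(2) T[OF al(1)] by (rule imageI)
  qed
  moreover have "labeling p \<in> arithmetical_structures (P1 n)" if p: "p \<in> ?T" for p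
  proof -
    obtain a l where al: "p = (a, l)" "length l = n"
      using p by (auto simp: slice_def)
    show ?thesis
      using p unfolding al(1) T[OF al(2)] .
  qed
  ultimately show ?thesis by blast
qed

theorem theorem3p2:
  fixes n :: nat
  assumes "n \<ge> 2"
  shows "real (card (arithmetical_structures (P1 n))) = 4 * catalan n - 2 * catalan (n - 1)"
proof -
  let ?S = "Pair (1 :: nat) ` slice (unit_chains 2) n" and ?T = "Pair (2 :: nat) ` slice (unit_chains 4) n"
    and ?U = "(\<lambda>l. (1 :: nat, map ((*) 2) l)) ` slice (unit_chains 1) n"
  have fin: "finite ?S" "finite ?T" "finite ?U"
    using counted_unit_chains_1[of n] counted_unit_chains_2[of n] counted_unit_chains_4[OF assms] assms
    by (simp_all add: counted_def)
  \<comment> \<open>Both families have \<open>a = 1\<close>; the last entry is 1 in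
    \<open>?S\<close> and 2 in \<open>?U\<close>.\<close>
  have "?S \<inter> ?U = {}"
  proof (intro equals0I)
    fix p assume "p \<in> ?S \<inter> ?U"
    then obtain l k where "l \<in> slice (unit_chains 2) n" "k \<in> slice (unit_chains 1) n" "l = map ((*) 2) k"
      by auto
    then have "last l = 1" "last k = 1" "k \<noteq> []" "l = map ((*) 2) k"
      using assms by (auto simp: slice_def unit_chains_def split: if_splits)
    then show False
      by (simp add: last_map)
  qed
  then have disj: "?S \<inter> ?T = {}" "(?S \<union> ?T) \<inter> ?U = {}"
    by auto
  have "inj (\<lambda>l. (1 :: nat, map ((*) (2 :: nat)) l))"
    by (auto intro!: injI dest: map_injective[OF _ injI])
  then have "card ?U = card (slice (unit_chains 1) n)"
    by (simp add: card_image inj_on_subset)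
  moreover have "card ?S = card (slice (unit_chains 2) n)" "card ?T = card (slice (unit_chains 4) n)"
    by (simp_all add: card_image inj_on_def)
  moreover have "inj_on labeling (?S \<union> ?T \<union> ?U)"
    by (rule inj_on_subset[OF inj_on_labeling[of n]]) (auto simp: slice_def)
  then have "card (arithmetical_structures (P1 n)) = card (?S \<union> ?T \<union> ?U)"
    using arithmetical_structures_P1[of n] assms by (simp add: card_image)
  moreover have "card (?S \<union> ?T \<union> ?U) = card ?S + card ?T + card ?U"
    using fin disj by (simp add: card_Un_disjoint)
  ultimately show ?thesis
    using counted_unit_chains_1[of n] counted_unit_chains_2[of n] counted_unit_chains_4[OF assms] assms
    by (simp add: counted_def)
qed

end
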